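(* Let $\alpha\ge0$ be real, let $f\in\mathcal{M}(\alpha)$, and let $\gamma_1,\gamma_2$ be its initial logarithmic coefficients. (i) If $0\le\alpha\le\frac{1+\sqrt3}{2}$, then $$-\frac{1}{\sqrt{2(\alpha^2+3\alpha+1)}}\le|\gamma_2|-|\gamma_1|\le\frac{1}{2(1+2\alpha)}.$$ (ii) If $\alpha\ge\frac{1+\sqrt3}{2}$, then $$-\frac{6\alpha^2+10\alpha+3}{4(2\alpha+1)(\alpha^2+3\alpha+1)}\le|\gamma_2|-|\gamma_1|\le\frac{1}{2(1+2\alpha)}.$$ The upper bounds are sharp: for each $\alpha\ge0$ there is a function in $\mathcal{M}(\alpha)$ for which $|\gamma_2|-|\gamma_1|=\frac{1}{2(1+2\alpha)}$.
   Context: Let $\mathbb{D}=\{z\in\mathbb{C}:|z|<1\}$ and let $\mathcal{A}$ be the class of functions $f$ analytic in $\mathbb{D}$ with $f(0)=0$, $f'(0)=1$, i.e. $f(z)=z+a_2z^2+a_3z^3+\cdots$. The logarithmic coefficients $\gamma_n$ of $f$ are defined by $\log\frac{f(z)}{z}=2\sum_{n=1}^\infty\gamma_nz^n$ (near $z=0$, with the branch vanishing at $0$); in particular $\gamma_1=\frac{a_2}{2}$ and $\gamma_2=\frac12\left(a_3-\frac12a_2^2\right)$. For real $\alpha$, the class of $\alpha$-convex functions is $$\mathcal{M}(\alpha)=\left\{f\in\mathcal{A}:\ \operatorname{Re}\left[(1-\alpha)\frac{zf'(z)}{f(z)}+\alpha\left(1+\frac{zf''(z)}{f'(z)}\right)\right]>0,\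 z\in\mathbb{D}\right\},$$ where $zf'(z)/f(z)$ takes the value $1$ at $z=0$, and the condition is understood to include that the bracketed expression is analytic in $\mathbb{D}$. *)

theory Defs
  imports "HOL-Complex_Analysis.Complex_Analysis"
begin

definition class_A :: "(complex \<Rightarrow> complex) set" where
  "class_A = {f. f holomorphic_on ball 0 1 \<and> f 0 = 0 \<and> deriv f 0 = 1}"

definition quot_id :: "(complex \<Rightarrow> complex) \<Rightarrow> complex \<Rightarrow> complex" where
  "quot_id f z = (if z = 0 then 1 else f z / z)"

text \<open>
  The logarithmic coefficients of \<open>f\<close> are half the Taylor coefficients at \<open>0\<close> of
  \<open>log (f z / z)\<close>. The principal logarithm is the branch that vanishes at \<open>0\<close>, since
  \<open>quot_id f\<close> is close to \<open>1\<close> near \<open>0\<close>. The lemma \<open>log_coeff_sums\<close> below recovers the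
  defining expansion.
\<close>

definition log_coeff :: "(complex \<Rightarrow> complex) \<Rightarrow> nat \<Rightarrow> complex" where
  "log_coeff f n = (deriv ^^ n) (\<lambda>z. Ln (quot_id f z)) 0 / (2 * fact n)"

definition alpha_convex_expr :: "real \<Rightarrow> (complex \<Rightarrow> complex) \<Rightarrow> complex \<Rightarrow> complex" where
  "alpha_convex_expr \<alpha> f z =
     (1 - of_real \<alpha>) * (if z = 0 then 1 else z * deriv f z / f z)
     + of_real \<alpha> * (1 + z * deriv (deriv f) z / deriv f z)"

text \<open>
  Analyticity of the bracketed expression on the disc is understood up to removable singularities:
  \<open>p\<close> is its analytic continuation across the (isolated) zeros of \<open>f\<close> and of \<open>deriv f\<close>.
  The values that division by zero would give at these points are not used.
\<close>

definition alpha_convex :: "real \<Rightarrow> (complex \<Rightarrow> complex) set" where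
  "alpha_convex \<alpha> = {f \<in> class_A. \<exists>p. p holomorphic_on ball 0 1 \<and>
     (\<forall>z\<in>ball 0 1. (z = 0 \<or> f z \<noteq> 0) \<and> deriv f z \<noteq> 0 \<longrightarrow> p z = alpha_convex_expr \<alpha> f z) \<and>
     (\<forall>z\<in>ball 0 1. Re (p z) > 0)}"

lemma quot_id_holomorphic:
  assumes "f \<in> class_A"
  shows "quot_id f holomorphic_on ball 0 1"
proof -
  have "(\<lambda>z. if z = 0 then deriv f 0 else f z / z) holomorphic_on ball 0 1"
    by (rule pole_theorem_open_0[of f _ 0]) (use assms in \<open>auto simp: class_A_def\<close>)
  also have "(\<lambda>z. if z = 0 then deriv f 0 else f z / z) = quot_id f"
    using assms by (auto simp: class_A_def quot_id_def fun_eq_iff)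
  finally show ?thesis .
qed

lemma log_coeff_sums:
  assumes "f \<in> class_A"
  shows "\<forall>\<^sub>F z in at 0. (\<lambda>n. 2 * log_coeff f (Suc n) * z ^ Suc n) sums Ln (f z / z)"
proof -
  have hol: "quot_id f holomorphic_on ball 0 1"
    by (rule quot_id_holomorphic[OF assms])
  have q0: "quot_id f 0 = 1" by (simp add: quot_id_def)
  have "isCont (quot_id f) 0"
    using holomorphic_on_imp_continuous_on[OF hol] by (simp add: continuous_on_eq_continuous_at)
  then obtain d where d: "d > 0" "\<And>z. dist z 0 < d \<Longrightarrow> dist (quot_id f z) 1 < 1"
    unfolding continuous_at_eps_delta q0 by (metis zero_less_one)
  define r where "r = min d 1"
  have r: "r > 0" "r \<le> 1" "r \<le> d" using d by (auto simp: r_def)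
  have "quot_id f z \<notin> \<real>\<^sub>\<le>\<^sub>0" if "z \<in> ball 0 r" for z
  proof -
    have "norm (quot_id f z - 1) < 1" using d(2)[of z] that r by (auto simp: dist_norm)
    then have "Re (quot_id f z) > 0"
      using abs_Re_le_cmod[of "quot_id f z - 1"] by simp
    then show ?thesis using complex_nonpos_Reals_iff by force
  qed
  then have L: "(\<lambda>z. Ln (quot_id f z)) holomorphic_on ball 0 r"
    using r by (intro holomorphic_on_Ln' holomorphic_on_subset[OF hol]) auto
  have "(\<lambda>n. 2 * log_coeff f (Suc n) * z ^ Suc n) sums Ln (f z / z)"
    if z: "z \<in> ball 0 r" "z \<noteq> 0" for z
  proof -
    have "(\<lambda>n. 2 * log_coeff f n * z ^ n) sums Ln (quot_id f z)"
      using holomorphic_power_series[OF L z(1)] by (simp add: log_coeff_def)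
    moreover have "log_coeff f 0 = 0" by (simp add: log_coeff_def q0)
    ultimately show ?thesis
      using z(2) sums_Suc_iff[of "\<lambda>n. 2 * log_coeff f n * z ^ n"] by (simp add: quot_id_def)
  qed
  then show ?thesis
    using r(1) unfolding eventually_at by (auto simp: dist_norm)
qed

end

theory Submission
  imports Defs
begin

text \<open>
  Let \<open>p\<close> be the bracketed expression and write \<open>(p - 1) / (p + 1) = z h\<close>. By the Schwarz lemma
  \<open>h\<close> maps the disc into its closure, so Schwarz--Pick bounds \<open>d = h' 0\<close> by \<open>1 - \<bar>h 0\<bar>\<^sup>2\<close>.
  Comparing Taylor coefficients gives \<open>h 0 = (1 + \<alpha>) \<gamma>\<^sub>1\<close> and
  \<open>2 (1 + 2 \<alpha>) \<gamma>\<^sub>2 = d + (\<alpha>\<^sup>2 + 4 \<alpha> + 1) \<gamma>\<^sub>1\<^sup>2\<close>, and the three bounds become statements about a quadratic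
  polynomial in \<open>\<bar>\<gamma>\<^sub>1\<bar>\<close>.

  The upper bound is attained for \<open>h z = z\<close>, that is for \<open>p z = (1 + z\<^sup>2) / (1 - z\<^sup>2)\<close>. A function \<open>f\<close>
  with this \<open>p\<close> is found by solving for \<open>q = f / (z f')\<close>, which satisfies the linear equation
  \<open>q p + \<alpha> z q' = 1\<close>; the point is that \<open>q\<close> has no zeros.
\<close>

section \<open>Taylor coefficients of functions with positive real part\<close>

text \<open>Following \<open>f\<close> by the disc automorphism that sends \<open>f 0\<close> to
  \<open>0\<close> gives a map \<open>g\<close> to which the Schwarz lemma applies, so
  \<open>norm (deriv g 0) \<le> 1\<close>. This needs values in the open disc; if modulus 1 is
  attained, the maximum modulus principle makes \<open>f\<close> constant and both sides are
  zero.\<close>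

lemma Schwarz_Pick_at_0:
  assumes hol: "f holomorphic_on ball 0 1" and le: "\<And>z. norm z < 1 \<Longrightarrow> norm (f z) \<le> 1"
  shows "norm (deriv f 0) \<le> 1 - (norm (f 0))\<^sup>2"
proof (cases "\<exists>z\<in>ball 0 1. norm (f z) = 1")
  case True
  then obtain \<xi> where \<xi>: "\<xi> \<in> ball 0 1" "norm (f \<xi>) = 1" by blast
  have "f constant_on ball 0 1"
    by (rule maximum_modulus_principle[OF hol, of "ball 0 1" \<xi>]) (use \<xi> le in auto)
  then obtain c where c: "\<And>z. z \<in> ball 0 1 \<Longrightarrow> f z = c"
    by (auto simp: constant_on_def)
  have "eventually (\<lambda>z. f z = c) (nhds 0)"
    using eventually_nhds_in_open[of "ball 0 1" 0] c by (auto elim: eventually_mono)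
  then have "deriv f 0 = deriv (\<lambda>_. c) 0" by (intro deriv_cong_ev refl)
  moreover have "norm (f 0) = 1" using \<xi> c[of 0] c[of \<xi>] by simp
  ultimately show ?thesis by simp
next
  case False
  with le have lt: "norm (f z) < 1" if "norm z < 1" for z
    using that by (simp add: order_less_le)
  define c where "c = f 0"
  have c: "norm c < 1" using lt by (simp add: c_def)
  define g where "g = Moebius_function 0 c \<circ> f"
  have g_hol: "g holomorphic_on ball 0 1"
    unfolding g_def
    by (rule holomorphic_on_compose_gen[OF hol Moebius_function_holomorphic[OF c]]) (use lt in auto)
  have g0: "g 0 = 0" by (simp add: g_def c_def Moebius_function_eq_zero)
  have "norm (deriv g 0) \<le> 1"
    by (rule Schwarz_Lemma(2)[OF g_hol g0, of 0])
      (use lt c Moebius_function_norm_lt_1 in \<open>auto simp: g_def\<close>)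
  have ne: "1 - cnj c * f z \<noteq> 0" if "norm z < 1" for z
  proof -
    have "norm (cnj c * f z) < 1 * 1"
      unfolding norm_mult by (intro mult_strict_mono') (use lt[OF that] c in auto)
    then show ?thesis by auto
  qed
  \<comment> \<open>With the denominator of the Moebius map cleared and \<open>g 0 = 0\<close>,
    differentiating both sides at 0 relates \<open>deriv f 0\<close> to \<open>deriv g 0\<close>
    without a quotient rule.\<close>
  have ev: "eventually (\<lambda>z. f z - c = g z * (1 - cnj c * f z)) (nhds 0)"
    using eventually_nhds_in_open[of "ball 0 1" 0] ne
    by (auto simp: g_def Moebius_function_simple elim!: eventually_mono)
  have [derivative_intros]: "(f has_field_derivative deriv f 0) (at 0)"
    "(g has_field_derivative deriv g 0) (at 0)"
    using hol g_hol by (auto intro!: holomorphic_derivI[of _ "ball 0 1"])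
  have "((\<lambda>z. f z - c) has_field_derivative deriv f 0) (at 0)"
    by (auto intro!: derivative_eq_intros)
  moreover have "((\<lambda>z. g z * (1 - cnj c * f z)) has_field_derivative
      deriv g 0 * (1 - cnj c * c)) (at 0)"
    by (auto intro!: derivative_eq_intros simp: g0 c_def)
  ultimately have "deriv f 0 = deriv g 0 * (1 - cnj c * c)"
    using ev DERIV_cong_ev[OF refl ev refl] DERIV_unique by blast
  moreover have "1 - cnj c * c = of_real (1 - (norm c)\<^sup>2)"
    by (subst mult.commute) (simp add: complex_norm_square[symmetric])
  ultimately have "norm (deriv f 0) = norm (deriv g 0) * \<bar>1 - (norm c)\<^sup>2\<bar>"
    by (simp only: norm_mult norm_of_real)
  also have "\<bar>1 - (norm c)\<^sup>2\<bar> = 1 - (norm c)\<^sup>2"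
    using c by (simp add: abs_square_le_1)
  also have "norm (deriv g 0) * \<dots> \<le> 1 * (1 - (norm c)\<^sup>2)"
    using c \<open>norm (deriv g 0) \<le> 1\<close> by (intro mult_right_mono) (auto simp: abs_square_le_1)
  finally show ?thesis by (simp add: c_def)
qed

text \<open>The bridge from division-free functional equations near 0 to formal power series, where
  coefficients are then compared.\<close>

lemma has_fps_expansion_eqI:
  fixes f g :: "complex \<Rightarrow> complex"
  assumes "f has_fps_expansion F" "g has_fps_expansion G" "eventually (\<lambda>z. f z = g z) (nhds 0)"
  shows "F = G"
proof -
  have "g has_fps_expansion F"
    using has_fps_expansion_cong[OF assms(3) refl] assms(1) by simp
  then show ?thesis using assms(2) fps_expansion_eqI by metis
qed

lemma holomorphic_on_ball_has_fps_expansion: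
  assumes "f holomorphic_on ball 0 r" "r > 0"
  shows "f has_fps_expansion fps_expansion f 0"
  by (rule has_fps_expansion_fps_expansion[OF _ _ assms(1)]) (use assms(2) in auto)

lemma fps_expansion_nth_le_1:
  shows "fps_nth (fps_expansion f 0) 0 = f 0"
    and "fps_nth (fps_expansion f 0) (Suc 0) = deriv f 0"
  by (simp_all add: fps_expansion_def)

text \<open>The Cayley transform of \<open>p\<close> factors as \<open>z * h z\<close>, and
  \<open>c = h 0\<close>, \<open>d = deriv h 0\<close>. The coefficients of \<open>P\<close> come
  from \<open>P - 1 = X H (P + 1)\<close>, and the bound on \<open>d\<close> is Schwarz--Pick for
  \<open>h\<close>.\<close>

lemma Caratheodory_coeffs:
  assumes hol: "p holomorphic_on ball 0 1" and p0: "p 0 = 1"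
    and pos: "\<And>z. z \<in> ball 0 1 \<Longrightarrow> Re (p z) > 0"
    and P: "p has_fps_expansion P"
  obtains c d where "fps_nth P 1 = 2 * c" "fps_nth P 2 = 2 * (d + c\<^sup>2)"
    "norm d \<le> 1 - (norm c)\<^sup>2"
proof -
  define w where "w = (\<lambda>z. (p z - 1) / (p z + 1))"
  have ne: "p z + 1 \<noteq> 0" if "z \<in> ball 0 1" for z
    using pos[OF that] by (auto simp: complex_eq_iff)
  have w_hol: "w holomorphic_on ball 0 1"
    unfolding w_def by (intro holomorphic_intros hol ne)
  have w0: "w 0 = 0" by (simp add: w_def p0)
  have w_lt: "norm (w z) < 1" if "norm z < 1" for z
  proof -
    \<comment> \<open>The squares of the two sides differ by \<open>4 * Re (p z)\<close>.\<close>
    have "norm (p z - 1) < norm (p z + 1)"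
      using pos[of z] that by (simp add: cmod_def power2_eq_square algebra_simps)
    then show ?thesis using ne[of z] that by (simp add: w_def norm_divide)
  qed
  obtain h where h_hol: "h holomorphic_on ball 0 1" and wh: "\<And>z. norm z < 1 \<Longrightarrow> w z = z * h z"
    and dw0: "deriv w 0 = h 0"
    using Schwarz3[OF w_hol w0] by blast
  have h_ne0: "norm (h z) \<le> 1" if "norm z < 1" "z \<noteq> 0" for z
    using Schwarz_Lemma(1)[OF w_hol w0 w_lt that(1)] that by (simp add: wh norm_mult)
  \<comment> \<open>At 0 one cannot divide by \<open>z\<close>; there
    \<open>h 0 = deriv w 0\<close>, which the derivative part of the Schwarz lemma bounds.\<close>
  have h_le: "norm (h z) \<le> 1" if "norm z < 1" for z
  proof (cases "z = 0")
    case True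
    then show ?thesis
      using Schwarz_Lemma(2)[OF w_hol w0 w_lt, of 0] dw0 by simp
  qed (use h_ne0 that in auto)
  define H where "H = fps_expansion h 0"
  have H: "h has_fps_expansion H"
    unfolding H_def by (rule holomorphic_on_ball_has_fps_expansion[OF h_hol]) simp
  have ev: "eventually (\<lambda>z. p z - 1 = (z * h z) * (p z + 1)) (nhds 0)"
  proof (rule eventually_mono)
    show "eventually (\<lambda>z. z \<in> ball 0 1) (nhds (0::complex))"
      by (rule eventually_nhds_in_open) auto
    show "p z - 1 = (z * h z) * (p z + 1)" if "z \<in> ball 0 1" for z
      using ne[OF that] that by (simp add: w_def flip: wh)
  qed
  have eq: "P - 1 = (fps_X * H) * (P + 1)"
    by (rule has_fps_expansion_eqI[OF _ _ ev]) (intro fps_expansion_intros P H)+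
  have P0: "fps_nth P 0 = 1"
    using has_fps_expansion_imp_0_eq_fps_nth_0[OF P] p0 by simp
  have "fps_nth (P - 1) 1 = fps_nth ((fps_X * H) * (P + 1)) 1"
    using eq by simp
  then have P1: "fps_nth P 1 = 2 * fps_nth H 0"
    by (simp add: fps_mult_nth P0)
  have "fps_nth (P - 1) 2 = fps_nth ((fps_X * H) * (P + 1)) 2"
    using eq by simp
  then have P2: "fps_nth P 2 = 2 * (fps_nth H 1 + (fps_nth H 0)\<^sup>2)"
    using P1 by (simp add: fps_mult_nth P0 numeral_2_eq_2 algebra_simps)
  show ?thesis
  proof (rule that[OF P1 P2])
    show "norm (fps_nth H 1) \<le> 1 - (norm (fps_nth H 0))\<^sup>2"
      using Schwarz_Pick_at_0[OF h_hol h_le] by (simp add: H_def fps_expansion_nth_le_1)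
  qed
qed

section \<open>The bracketed expression in terms of logarithmic coefficients\<close>

text \<open>Write \<open>f z = z * exp (L z)\<close> near 0. Logarithmic differentiation gives
  \<open>z f' / f = 1 + z L'\<close> and
  \<open>1 + z f'' / f' = 1 + z L' + z (L' + z L'') / (1 + z L')\<close>. Multiplying by
  \<open>1 + z L'\<close> leaves a polynomial identity in \<open>p\<close>, \<open>L'\<close> and
  \<open>L''\<close>, whose coefficients of order 1 and 2 are compared.\<close>

lemma alpha_convex_coeffs:
  assumes f: "f \<in> class_A"
    and p: "p has_fps_expansion P"
    and p_eq: "\<And>z. z \<in> ball 0 1 \<Longrightarrow> z = 0 \<or> f z \<noteq> 0 \<Longrightarrow> deriv f z \<noteq> 0 \<Longrightarrow>
      p z = alpha_convex_expr \<alpha> f z"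
  shows "fps_nth P 1 = 2 * (1 + of_real \<alpha>) * log_coeff f 1"
    and "fps_nth P 2 = 4 * (1 + 2 * of_real \<alpha>) * log_coeff f 2 - 4 * of_real \<alpha> * (log_coeff f 1)\<^sup>2"
proof -
  have g_hol: "quot_id f holomorphic_on ball 0 1"
    by (rule quot_id_holomorphic[OF f])
  have f_hol: "f holomorphic_on ball 0 1" and f0: "f 0 = 0" "deriv f 0 = 1"
    using f by (auto simp: class_A_def)
  have g0: "quot_id f 0 = 1" by (simp add: quot_id_def)
  have fg: "f z = z * quot_id f z" for z by (simp add: quot_id_def f0)
  have "isCont (quot_id f) 0" "isCont (deriv f) 0"
    using holomorphic_on_imp_continuous_on[OF g_hol]
      holomorphic_on_imp_continuous_on[OF holomorphic_deriv[OF f_hol]]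
    by (simp_all add: continuous_on_eq_continuous_at)
  then have "(quot_id f \<longlongrightarrow> 1) (nhds 0)" "(deriv f \<longlongrightarrow> 1) (nhds 0)"
    unfolding isCont_def tendsto_at_iff_tendsto_nhds using g0 f0 by simp_all
  from topological_tendstoD[OF this(1), of "- \<real>\<^sub>\<le>\<^sub>0"] topological_tendstoD[OF this(2), of "- {0}"]
  have "eventually (\<lambda>z. quot_id f z \<in> - \<real>\<^sub>\<le>\<^sub>0) (nhds 0)" "eventually (\<lambda>z. deriv f z \<in> - {0}) (nhds 0)"
    by (auto simp: open_Compl)
  \<comment> \<open>On a small disc \<open>quot_id f\<close> avoids the branch cut, so its logarithm
    is holomorphic, and \<open>deriv f\<close> has no zeros, so \<open>p\<close> agrees there with
    the bracketed expression.\<close>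
  then have "eventually (\<lambda>z. quot_id f z \<in> - \<real>\<^sub>\<le>\<^sub>0 \<and> deriv f z \<noteq> 0 \<and> z \<in> ball 0 1) (nhds 0)"
    using eventually_nhds_in_open[of "ball 0 1" "0::complex"] by (auto intro: eventually_conj)
  then obtain e where e: "e > 0" and
    "\<And>z. dist z 0 < e \<Longrightarrow> quot_id f z \<in> - \<real>\<^sub>\<le>\<^sub>0 \<and> deriv f z \<noteq> 0 \<and> z \<in> ball 0 1"
    unfolding eventually_nhds_metric by blast
  then have slit: "quot_id f z \<notin> \<real>\<^sub>\<le>\<^sub>0" and df: "deriv f z \<noteq> 0" and in1: "z \<in> ball 0 1"
    if "z \<in> ball 0 e" for z
    using that by (auto simp: dist_commute)
  define L where "L = (\<lambda>z. Ln (quot_id f z))"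
  have L_hol: "L holomorphic_on ball 0 e" unfolding L_def
    using in1 slit by (intro holomorphic_on_Ln' holomorphic_on_subset[OF g_hol]) auto
  have L1_hol: "deriv L holomorphic_on ball 0 e"
    by (rule holomorphic_deriv[OF L_hol]) simp
  have eq: "(p z - 1 - z * deriv L z) * (1 + z * deriv L z)
      = of_real \<alpha> * (z * (deriv L z + z * deriv (deriv L) z))"
    if z: "z \<in> ball 0 e" for z
  proof -
    have expL: "f z = z * exp (L z)" if "z \<in> ball 0 e" for z
      using slit[OF that] unfolding L_def by (subst fg, subst exp_Ln) auto
    have dL: "(L has_field_derivative deriv L z) (at z)"
      "(deriv L has_field_derivative deriv (deriv L) z) (at z)"
      if "z \<in> ball 0 e" for z
      using that by (auto intro!: holomorphic_derivI[OF L_hol] holomorphic_derivI[OF L1_hol])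
    have df1: "deriv f z = exp (L z) * (1 + z * deriv L z)" if z: "z \<in> ball 0 e" for z
    proof (rule DERIV_imp_deriv)
      have "((\<lambda>z. z * exp (L z)) has_field_derivative exp (L z) * (1 + z * deriv L z)) (at z)"
        using dL(1)[OF z] by (auto intro!: derivative_eq_intros simp: algebra_simps)
      then show "(f has_field_derivative exp (L z) * (1 + z * deriv L z)) (at z)"
        by (rule has_field_derivative_transform_within_open[OF _ open_ball z]) (simp add: expL)
    qed
    have df2: "deriv (deriv f) z = exp (L z) * (deriv L z * (1 + z * deriv L z) + deriv L z + z * deriv (deriv L) z)"
    proof (rule DERIV_imp_deriv)
      have "((\<lambda>z. exp (L z) * (1 + z * deriv L z)) has_field_derivative
         exp (L z) * (deriv L z * (1 + z * deriv L z) + deriv L z + z * deriv (deriv L) z)) (at z)"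
        using dL[OF z] by (auto intro!: derivative_eq_intros simp: algebra_simps)
      then show "(deriv f has_field_derivative
         exp (L z) * (deriv L z * (1 + z * deriv L z) + deriv L z + z * deriv (deriv L) z)) (at z)"
        by (rule has_field_derivative_transform_within_open[OF _ open_ball z]) (simp add: df1)
    qed
    have ne: "1 + z * deriv L z \<noteq> 0" using df[OF z] df1[OF z] by auto
    have "p z = alpha_convex_expr \<alpha> f z"
      using p_eq[OF in1[OF z]] expL[OF z] df[OF z] by auto
    also have "\<dots> = (1 - of_real \<alpha>) * (1 + z * deriv L z)
        + of_real \<alpha> * (1 + z * (deriv L z * (1 + z * deriv L z) + deriv L z + z * deriv (deriv L) z) / (1 + z * deriv L z))"
      unfolding alpha_convex_expr_def df1[OF z] df2 expL[OF z] by simp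
    finally have "p z * (1 + z * deriv L z) = (1 - of_real \<alpha>) * (1 + z * deriv L z) ^ 2
        + of_real \<alpha> * ((1 + z * deriv L z) + z * (deriv L z * (1 + z * deriv L z) + deriv L z + z * deriv (deriv L) z))"
      using ne by (simp add: divide_simps power2_eq_square)
    moreover have "(p z - 1 - z * deriv L z) * (1 + z * deriv L z)
        = p z * (1 + z * deriv L z) - (1 + z * deriv L z) ^ 2"
      by (simp add: algebra_simps power2_eq_square)
    ultimately show ?thesis
      by (simp add: algebra_simps power2_eq_square)
  qed
  define l where "l = fps_expansion L 0"
  have l: "L has_fps_expansion l"
    unfolding l_def by (rule holomorphic_on_ball_has_fps_expansion[OF L_hol e])
  have ev: "eventually (\<lambda>z. (p z - 1 - z * deriv L z) * (1 + z * deriv L z)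
      = of_real \<alpha> * (z * (deriv L z + z * deriv (deriv L) z))) (nhds 0)"
    using eventually_nhds_in_open[of "ball 0 e" 0] eq e by (auto elim!: eventually_mono)
  have fps: "(P - 1 - fps_X * fps_deriv l) * (1 + fps_X * fps_deriv l)
      = fps_const (of_real \<alpha>) * (fps_X * (fps_deriv l + fps_X * fps_deriv (fps_deriv l)))"
    by (rule has_fps_expansion_eqI[OF _ _ ev]) (intro fps_expansion_intros p l)+
  have "p 0 = 1" using p_eq[of 0] f0 by (simp add: alpha_convex_expr_def)
  then have P0: "fps_nth P 0 = 1"
    using has_fps_expansion_imp_0_eq_fps_nth_0[OF p] by simp
  have lc: "fps_nth l n = 2 * log_coeff f n" for n
    by (simp add: l_def fps_expansion_def log_coeff_def L_def)
  have "fps_nth ((P - 1 - fps_X * fps_deriv l) * (1 + fps_X * fps_deriv l)) 1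
      = fps_nth (fps_const (of_real \<alpha>) * (fps_X * (fps_deriv l + fps_X * fps_deriv (fps_deriv l)))) 1"
    using fps by simp
  then have P1: "fps_nth P 1 = (1 + of_real \<alpha>) * fps_nth l 1"
    by (simp add: fps_mult_nth P0 algebra_simps)
  then show "fps_nth P 1 = 2 * (1 + of_real \<alpha>) * log_coeff f 1"
    by (simp add: lc)
  have "fps_nth ((P - 1 - fps_X * fps_deriv l) * (1 + fps_X * fps_deriv l)) 2
      = fps_nth (fps_const (of_real \<alpha>) * (fps_X * (fps_deriv l + fps_X * fps_deriv (fps_deriv l)))) 2"
    using fps by simp
  then have "fps_nth P 2 = (2 + 4 * of_real \<alpha>) * fps_nth l 2 - of_real \<alpha> * (fps_nth l 1)\<^sup>2"
    using P1 by (simp add: fps_mult_nth fps_numeral_nth P0 numeral_2_eq_2 algebra_simps)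
  then show "fps_nth P 2 = 4 * (1 + 2 * of_real \<alpha>) * log_coeff f 2 - 4 * of_real \<alpha> * (log_coeff f 1)\<^sup>2"
    by (simp add: lc algebra_simps)
qed

section \<open>Existence of an \<alpha>-convex function with prescribed bracketed expression\<close>

text \<open>On Taylor coefficients the operator multiplies the \<open>n\<close>-th one by
  \<open>1 + a n\<close>. For \<open>a \<ge> 0\<close> these factors have modulus at least 1, so
  dividing by them keeps convergence on the whole disc.\<close>

lemma euler_ode_solution:
  fixes a :: real
  assumes h_hol: "h holomorphic_on ball 0 1" and a: "a \<ge> 0"
  obtains g where "g holomorphic_on ball 0 1"
    "\<And>z. z \<in> ball 0 1 \<Longrightarrow> g z + of_real a * z * deriv g z = h z"
proof -
  define H where "H = fps_expansion h 0"
  define G where "G = Abs_fps (\<lambda>n. fps_nth H n / (1 + of_real a * of_nat n))"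
  have H_rad: "fps_conv_radius H \<ge> 1"
    unfolding H_def by (rule conv_radius_fps_expansion) (use h_hol in \<open>simp add: one_ereal_def\<close>)
  have H_eval: "eval_fps H z = h z" if "z \<in> ball 0 1" for z
    unfolding H_def using eval_fps_expansion'[of h 0 1 z] h_hol that by (simp add: one_ereal_def)
  have norm_ge: "norm (1 + of_real a * of_nat n :: complex) \<ge> 1" for n
  proof -
    have "1 \<le> Re (1 + of_real a * of_nat n :: complex)" using a by simp
    then show ?thesis using complex_Re_le_cmod order_trans by blast
  qed
  then have ne: "1 + of_real a * of_nat n \<noteq> (0 :: complex)" for n
    by (metis norm_zero not_one_le_zero)
  have "conv_radius (fps_nth G) \<ge> 1"
  proof (rule conv_radius_geI_ex')
    fix r :: real assume r: "0 < r" "ereal r < 1"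
    have "summable (\<lambda>n. norm (fps_nth H n * of_real r ^ n))"
      using r less_le_trans[OF r(2) H_rad] unfolding fps_conv_radius_def
      by (intro abs_summable_in_conv_radius) auto
    then show "summable (\<lambda>n. fps_nth G n * of_real r ^ n)"
    proof (rule summable_comparison_test'[where N = 0])
      fix n
      have "norm (fps_nth H n) \<le> norm (fps_nth H n) * norm (1 + of_real a * of_nat n :: complex)"
        using mult_left_mono[OF norm_ge[of n] norm_ge_zero[of "fps_nth H n"]] by simp
      then have "norm (fps_nth G n) \<le> norm (fps_nth H n)"
        using ne[of n] by (simp add: G_def norm_divide divide_simps)
      then show "norm (fps_nth G n * of_real r ^ n) \<le> norm (fps_nth H n * of_real r ^ n)"
        unfolding norm_mult by (rule mult_right_mono) simp
    qed
  qed
  then have G_rad: "fps_conv_radius G \<ge> 1" by (simp add: fps_conv_radius_def)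
  have lt: "ereal (norm z) < fps_conv_radius G" if "z \<in> ball 0 1" for z
    by (rule less_le_trans[OF _ G_rad]) (use that in auto)
  show ?thesis
  proof (rule that[of "eval_fps G"])
    show "eval_fps G holomorphic_on ball 0 1"
      by (rule holomorphic_on_eval_fps) (use lt in auto)
    fix z :: complex assume z: "z \<in> ball 0 1"
    have "deriv (eval_fps G) z = eval_fps (fps_deriv G) z"
      by (rule DERIV_imp_deriv, rule has_field_derivative_eval_fps[OF lt[OF z]])
    moreover have "G + fps_const (of_real a) * (fps_X * fps_deriv G) = H"
    proof (rule fps_ext)
      fix n
      have "fps_nth (G + fps_const (of_real a) * (fps_X * fps_deriv G)) n
          = (1 + of_real a * of_nat n) * fps_nth G n"
        by (cases n) (auto simp: algebra_simps)
      also have "\<dots> = fps_nth H n" using ne[of n] by (simp add: G_def)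
      finally show "fps_nth (G + fps_const (of_real a) * (fps_X * fps_deriv G)) n = fps_nth H n" .
    qed
    moreover have "eval_fps (G + fps_const (of_real a) * (fps_X * fps_deriv G)) z
        = eval_fps G z + of_real a * (z * eval_fps (fps_deriv G) z)"
    proof -
      have r1: "ereal (norm z) < fps_conv_radius (fps_deriv G)"
        using lt[OF z] fps_conv_radius_deriv[of G] by (rule less_le_trans)
      have r2: "ereal (norm z) < fps_conv_radius (fps_X * fps_deriv G)"
        using r1 fps_conv_radius_mult[of fps_X "fps_deriv G"]
        by (auto intro: less_le_trans)
      have r3: "ereal (norm z) < fps_conv_radius (fps_const (of_real a) * (fps_X * fps_deriv G))"
        using r2 fps_conv_radius_mult[of "fps_const (of_real a)" "fps_X * fps_deriv G"]
        by (auto intro: less_le_trans)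
      show ?thesis
        using lt[OF z] r1 r2 r3 by (simp add: eval_fps_add eval_fps_mult)
    qed
    ultimately show "eval_fps G z + of_real a * z * deriv (eval_fps G) z = h z"
      using H_eval[OF z] by (simp add: mult.assoc)
  qed
qed

text \<open>Since \<open>q 0 = 0\<close>, the quotient \<open>q z / z\<close> extends
  holomorphically to the disc and has a primitive there. This supplies the exponents of an
  integrating factor and of \<open>f z / z\<close>.\<close>

lemma zero_factor_primitive:
  assumes q: "q holomorphic_on ball 0 1" "q 0 = 0"
  obtains m where "m holomorphic_on ball 0 1" "m 0 = 0"
    "\<And>z. z \<in> ball 0 1 \<Longrightarrow> z * deriv m z = q z"
proof -
  obtain s where s: "s holomorphic_on ball 0 1" "\<And>z. norm z < 1 \<Longrightarrow> q z = z * s z"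
    using Schwarz3[OF q] by blast
  obtain m where "\<And>z. z \<in> ball 0 1 \<Longrightarrow> (m has_field_derivative s z) (at z within ball 0 1)"
    using holomorphic_convex_primitive'[OF convex_ball open_ball s(1)] by blast
  then have m: "(m has_field_derivative s z) (at z)" if "z \<in> ball 0 1" for z
    using that by (metis at_within_open open_ball)
  have m': "((\<lambda>z. m z - m 0) has_field_derivative s z) (at z)" if "z \<in> ball 0 1" for z
    using m[OF that] by (auto intro!: derivative_eq_intros)
  show ?thesis
  proof (rule that[of "\<lambda>z. m z - m 0"])
    show "(\<lambda>z. m z - m 0) holomorphic_on ball 0 1"
      using m' by (auto simp: holomorphic_on_open intro!: exI)
  qed (use m'[THEN DERIV_imp_deriv] s in auto)
qed

text \<open>For \<open>a > 0\<close>, substituting \<open>q = g * exp (- m)\<close> with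
  \<open>z m' = (p - 1) / a\<close> reduces the equation to the Euler equation
  \<open>g + a z g' = exp m\<close>. For \<open>a = 0\<close> it is algebraic, with solution
  \<open>1 / p\<close>.\<close>

lemma linear_ode_solution:
  fixes a :: real
  assumes p: "p holomorphic_on ball 0 1" "p 0 = 1" "\<And>z. z \<in> ball 0 1 \<Longrightarrow> p z \<noteq> 0" and a: "a \<ge> 0"
  obtains q where "q holomorphic_on ball 0 1"
    "\<And>z. z \<in> ball 0 1 \<Longrightarrow> q z * p z + of_real a * z * deriv q z = 1"
proof (cases "a = 0")
  case True
  show ?thesis
    by (rule that[of "\<lambda>z. 1 / p z"]) (use p True in \<open>auto intro!: holomorphic_intros\<close>)
next
  case False
  obtain m where m: "m holomorphic_on ball 0 1" "m 0 = 0"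
     "\<And>z. z \<in> ball 0 1 \<Longrightarrow> z * deriv m z = (p z - 1) / of_real a"
    by (rule zero_factor_primitive[of "\<lambda>z. (p z - 1) / of_real a"])
      (use p False in \<open>auto intro!: holomorphic_intros\<close>)
  obtain g where g: "g holomorphic_on ball 0 1"
     "\<And>z. z \<in> ball 0 1 \<Longrightarrow> g z + of_real a * z * deriv g z = exp (m z)"
    by (rule euler_ode_solution[of "\<lambda>z. exp (m z)" a])
      (use a m in \<open>auto intro!: holomorphic_intros\<close>)
  show ?thesis
  proof (rule that[of "\<lambda>z. g z * exp (- m z)"])
    show "(\<lambda>z. g z * exp (- m z)) holomorphic_on ball 0 1"
      by (intro holomorphic_intros m g)
    fix z :: complex assume z: "z \<in> ball 0 1"
    have "((\<lambda>z. g z * exp (- m z)) has_field_derivative (deriv g z - g z * deriv m z) * exp (- m z)) (at z)"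
      using holomorphic_derivI[OF m(1) open_ball z] holomorphic_derivI[OF g(1) open_ball z]
      by (auto intro!: derivative_eq_intros simp: algebra_simps)
    then have "g z * exp (- m z) * p z + of_real a * z * deriv (\<lambda>z. g z * exp (- m z)) z
        = (g z * p z + of_real a * z * deriv g z - of_real a * g z * (z * deriv m z)) * exp (- m z)"
      by (simp add: DERIV_imp_deriv algebra_simps)
    also have "g z * p z + of_real a * z * deriv g z - of_real a * g z * (z * deriv m z) = exp (m z)"
      using False by (simp add: m(3)[OF z] g(2)[OF z, symmetric]) (simp add: field_simps)
    finally show "g z * exp (- m z) * p z + of_real a * z * deriv (\<lambda>z. g z * exp (- m z)) z = 1"
      by (simp add: exp_minus)
  qed
qed

text \<open>
  At a point \<open>w\<close> of least modulus with \<open>Re (q w) \<le> 0\<close>, the function \<open>Re q\<close> is minimal along the circle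
  and falls to \<open>0\<close> along the radius, so \<open>w * deriv q w\<close> is real and nonpositive. As \<open>q w\<close> is imaginary,
  the differential equation contradicts \<open>Re (p w) > 0\<close>.
\<close>

lemma linear_ode_solution_Re_pos:
  fixes a :: real
  assumes p: "p 0 = 1" "\<And>z. z \<in> ball 0 1 \<Longrightarrow> Re (p z) > 0" and a: "a \<ge> 0"
    and q: "q holomorphic_on ball 0 1"
    and ode: "\<And>z. z \<in> ball 0 1 \<Longrightarrow> q z * p z + of_real a * z * deriv q z = 1"
    and \<zeta>: "\<zeta> \<in> ball 0 1"
  shows "Re (q \<zeta>) > 0"
proof (rule ccontr)
  assume neg: "\<not> Re (q \<zeta>) > 0"
  \<comment> \<open>Restricting to the closed disc through \<open>\<zeta>\<close> makes the set
    compact, so that a point of least modulus exists.\<close>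
  define S where "S = {z \<in> cball 0 (norm \<zeta>). Re (q z) \<le> 0}"
  have sub: "cball 0 (norm \<zeta>) \<subseteq> ball 0 1" using \<zeta> by auto
  have "closed S" unfolding S_def
    by (intro continuous_on_closed_Collect_le continuous_intros closed_cball
        continuous_on_subset[OF holomorphic_on_imp_continuous_on[OF q] sub])
  moreover have "bounded S" unfolding S_def
    by (rule bounded_subset[OF bounded_cball[of 0 "norm \<zeta>"]]) auto
  ultimately have "compact S" by (simp add: compact_eq_bounded_closed)
  moreover have "S \<noteq> {}" using neg by (auto simp: S_def intro!: exI[of _ \<zeta>])
  ultimately obtain w where w: "w \<in> S" and w_min: "\<And>z. z \<in> S \<Longrightarrow> norm w \<le> norm z"
    using continuous_attains_inf[of S norm] by (auto intro: continuous_intros)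
  have w1: "w \<in> ball 0 1" and w\<zeta>: "norm w \<le> norm \<zeta>" using w \<zeta> by (auto simp: S_def)
  have pos: "Re (q z) > 0" if "norm z < norm w" for z
    using w_min[of z] that w\<zeta> by (force simp: S_def)
  have "q 0 = 1" using ode[of 0] p by simp
  then have "w \<noteq> 0" using w by (auto simp: S_def)
  have cont: "isCont q z" if "z \<in> ball 0 1" for z
    using holomorphic_on_imp_continuous_on[OF q] that by (simp add: continuous_on_eq_continuous_at)
  \<comment> \<open>Each point of the circle through \<open>w\<close> is a radial limit of points
    where \<open>Re q\<close> is positive.\<close>
  have nonneg: "Re (q z) \<ge> 0" if z: "norm z = norm w" for z
  proof (rule tendsto_lowerbound)
    have "z \<in> ball 0 1" using z w1 by simp
    moreover have "((\<lambda>t::real. of_real t * z) \<longlongrightarrow> z) (at_left 1)"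
      by (auto intro!: tendsto_eq_intros)
    ultimately show "((\<lambda>t::real. Re (q (of_real t * z))) \<longlongrightarrow> Re (q z)) (at_left 1)"
      by (intro tendsto_Re isCont_tendsto_compose[of z q] cont)
    have "eventually (\<lambda>t. t \<in> {0<..<1}) (at_left (1::real))"
      by (rule eventually_at_leftI[of 0]) auto
    then show "eventually (\<lambda>t. 0 \<le> Re (q (of_real t * z))) (at_left (1::real))"
    proof (rule eventually_mono)
      fix t :: real assume t: "t \<in> {0<..<1}"
      then have "norm (of_real t * z) < norm w"
        using z \<open>w \<noteq> 0\<close> by (simp add: norm_mult)
      then show "0 \<le> Re (q (of_real t * z))" using pos by (simp add: less_imp_le)
    qed
  qed simp
  then have Re_w: "Re (q w) = 0" using w by (force simp: S_def)
  have dq: "(q has_field_derivative deriv q w) (at w)"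
    by (rule holomorphic_derivI[OF q open_ball w1])
  have "((\<lambda>t. Re (q (w * cis t))) has_real_derivative Re (\<i> * w * deriv q w)) (at 0)"
  proof -
    have "((\<lambda>t. w * cis t) has_vector_derivative w * \<i>) (at 0)"
      unfolding cis_conv_exp
      by (rule has_vector_derivative_real_field) (auto intro!: derivative_eq_intros)
    then have "((q \<circ> (\<lambda>t. w * cis t)) has_vector_derivative (w * \<i>) * deriv q w) (at 0)"
      using dq by (intro field_vector_diff_chain_at) auto
    then have "((\<lambda>t. Re ((q \<circ> (\<lambda>t. w * cis t)) t)) has_vector_derivative
        Re ((w * \<i>) * deriv q w)) (at 0)"
      by (rule bounded_linear.has_vector_derivative[OF bounded_linear_Re])
    then show ?thesis by (simp add: has_real_derivative_iff_has_vector_derivative mult_ac)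
  qed
  then have "Re (\<i> * w * deriv q w) = 0"
    by (rule DERIV_local_min[of _ _ _ 1]) (auto simp: Re_w nonneg norm_mult)
  then have Im0: "Im (w * deriv q w) = 0" by (simp add: mult.assoc)
  have rad: "((\<lambda>t. Re (q (w * of_real t))) has_real_derivative Re (w * deriv q w)) (at 1)"
  proof -
    have "((\<lambda>t. w * of_real t) has_vector_derivative w) (at 1)"
      by (auto intro!: derivative_eq_intros simp: has_vector_derivative_def scaleR_conv_of_real)
    then have "((q \<circ> (\<lambda>t. w * of_real t)) has_vector_derivative w * deriv q w) (at 1)"
      using dq by (intro field_vector_diff_chain_at) auto
    then have "((\<lambda>t. Re ((q \<circ> (\<lambda>t. w * of_real t)) t)) has_vector_derivative
        Re (w * deriv q w)) (at 1)"
      by (rule bounded_linear.has_vector_derivative[OF bounded_linear_Re])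
    then show ?thesis by (simp add: has_real_derivative_iff_has_vector_derivative mult_ac)
  qed
  have Re_le: "Re (w * deriv q w) \<le> 0"
  proof (rule ccontr)
    assume "\<not> Re (w * deriv q w) \<le> 0"
    then obtain d where d: "d > 0"
      "\<And>h. h > 0 \<Longrightarrow> h < d \<Longrightarrow> Re (q (w * of_real (1 - h))) < Re (q (w * of_real 1))"
      using DERIV_pos_inc_left[OF rad] by (auto simp: not_le)
    define h where "h = min (d/2) (1/2)"
    have h: "h > 0" "h < d" "h < 1" using d by (auto simp: h_def)
    have "norm (w * of_real (1 - h)) = norm w * (1 - h)"
      using h unfolding norm_mult norm_of_real by simp
    also have "\<dots> < norm w" using h \<open>w \<noteq> 0\<close> by simp
    finally have "Re (q (w * of_real (1 - h))) > 0" by (rule pos)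
    with d(2)[OF h(1,2)] Re_w show False by simp
  qed
  define x where "x = Re (w * deriv q w)"
  have wx: "w * deriv q w = of_real x" using Im0 by (simp add: x_def complex_eq_iff)
  have qw: "q w = of_real (Im (q w)) * \<i>" using Re_w by (simp add: complex_eq_iff)
  \<comment> \<open>The product \<open>q w * p w\<close> is real and at least 1. Since
    \<open>q w\<close> is imaginary, the imaginary part of the product is
    \<open>Im (q w) * Re (p w)\<close>; its vanishing forces \<open>q w = 0\<close>, which is
    impossible.\<close>
  have ode_w: "q w * p w = of_real (1 - a * x)"
    using ode[OF w1] by (simp add: mult.assoc wx eq_diff_eq)
  have ge1: "1 - a * x \<ge> 1" using a Re_le by (simp add: x_def mult_nonneg_nonpos)
  have "Im (q w * p w) = 0" unfolding ode_w by simp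
  then have "Im (q w) * Re (p w) = 0" by (subst (asm) qw) simp
  then have "q w = 0" using p(2)[OF w1] qw by simp
  then show False using ode_w ge1 by (simp add: complex_eq_iff)
qed

text \<open>With \<open>q = f / (z f')\<close> the bracketed expression becomes
  \<open>(1 - \<alpha> z q') / q\<close>, so prescribing it as \<open>p\<close> means solving
  \<open>q p + \<alpha> z q' = 1\<close>. The solution has positive real part, hence no zeros, and
  \<open>f\<close> is recovered as \<open>z * exp m\<close> with
  \<open>1 + z m' = z f' / f = 1 / q\<close>.\<close>

lemma alpha_convex_exists:
  fixes \<alpha> :: real
  assumes p: "p holomorphic_on ball 0 1" "p 0 = 1" "\<And>z. z \<in> ball 0 1 \<Longrightarrow> Re (p z) > 0" and \<alpha>: "\<alpha> \<ge> 0"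
  obtains f where "f \<in> alpha_convex \<alpha>"
     "\<And>z. z \<in> ball 0 1 \<Longrightarrow> p z = alpha_convex_expr \<alpha> f z"
proof -
  have "p z \<noteq> 0" if "z \<in> ball 0 1" for z using p(3)[OF that] by auto
  then obtain q where q: "q holomorphic_on ball 0 1"
    and ode: "\<And>z. z \<in> ball 0 1 \<Longrightarrow> q z * p z + of_real \<alpha> * z * deriv q z = 1"
    using linear_ode_solution[of p \<alpha>] p \<alpha> by blast
  have q_ne: "q z \<noteq> 0" if "z \<in> ball 0 1" for z
    using linear_ode_solution_Re_pos[OF p(2,3) \<alpha> q ode that] by auto
  have q0: "q 0 = 1" using ode[of 0] p(2) by simp
  obtain m where m: "m holomorphic_on ball 0 1" "m 0 = 0"
     "\<And>z. z \<in> ball 0 1 \<Longrightarrow> z * deriv m z = 1 / q z - 1"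
    by (rule zero_factor_primitive[of "\<lambda>z. 1 / q z - 1"])
      (use q q0 q_ne in \<open>auto intro!: holomorphic_intros\<close>)
  define f where "f = (\<lambda>z. z * exp (m z))"
  have f_hol: "f holomorphic_on ball 0 1" unfolding f_def by (intro holomorphic_intros m)
  have df: "deriv f z = exp (m z) / q z" if z: "z \<in> ball 0 1" for z
  proof (rule DERIV_imp_deriv)
    have "(f has_field_derivative exp (m z) * (1 + z * deriv m z)) (at z)"
      unfolding f_def using holomorphic_derivI[OF m(1) open_ball z]
      by (auto intro!: derivative_eq_intros simp: algebra_simps)
    then show "(f has_field_derivative exp (m z) / q z) (at z)" by (simp add: m(3)[OF z])
  qed
  have ddf: "z * deriv (deriv f) z / deriv f z = 1 / q z - 1 - z * deriv q z / q z" if z: "z \<in> ball 0 1" for z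
  proof -
    have "((\<lambda>z. exp (m z) / q z) has_field_derivative
        exp (m z) / q z * (deriv m z - deriv q z / q z)) (at z)"
      using holomorphic_derivI[OF m(1) open_ball z] holomorphic_derivI[OF q(1) open_ball z] q_ne[OF z]
      by (auto intro!: derivative_eq_intros simp: divide_simps) (auto simp: algebra_simps)
    then have "(deriv f has_field_derivative exp (m z) / q z * (deriv m z - deriv q z / q z)) (at z)"
      by (rule has_field_derivative_transform_within_open[OF _ open_ball z]) (simp add: df)
    then have ddf_eq: "deriv (deriv f) z = deriv f z * (deriv m z - deriv q z / q z)"
      unfolding df[OF z] by (rule DERIV_imp_deriv)
    have "deriv f z \<noteq> 0" unfolding df[OF z] using q_ne[OF z] by simp
    then have "z * deriv (deriv f) z / deriv f z = z * deriv m z - z * deriv q z / q z"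
      unfolding ddf_eq by (simp, simp add: right_diff_distrib)
    then show ?thesis by (simp add: m(3)[OF z])
  qed
  have expr: "p z = alpha_convex_expr \<alpha> f z" if z: "z \<in> ball 0 1" for z
  proof -
    have "(if z = 0 then 1 else z * deriv f z / f z) = 1 / q z"
      using q0 by (simp add: df[OF z]) (simp add: f_def)
    then have "alpha_convex_expr \<alpha> f z
        = (1 - of_real \<alpha>) * (1 / q z) + of_real \<alpha> * (1 + (1 / q z - 1 - z * deriv q z / q z))"
      by (simp only: alpha_convex_expr_def ddf[OF z])
    also have "\<dots> = (1 - of_real \<alpha> * z * deriv q z) / q z"
      using q_ne[OF z] by (simp add: field_simps)
    also have "1 - of_real \<alpha> * z * deriv q z = q z * p z"
      using ode[OF z] by (simp add: algebra_simps)
    finally show ?thesis using q_ne[OF z] by simp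
  qed
  show ?thesis
  proof (rule that[OF _ expr])
    show "f \<in> alpha_convex \<alpha>"
      unfolding alpha_convex_def class_A_def using f_hol p expr df[of 0]
      by (auto simp: q0 m(2) f_def)
  qed
qed

text \<open>The real part equals \<open>(1 - |w|^2) / |1 - w|^2\<close>.\<close>

lemma Re_Cayley_pos:
  assumes "norm (w :: complex) < 1"
  shows "Re ((1 + w) / (1 - w)) > 0"
proof -
  have "w \<noteq> 1" using assms by auto
  then have "(1 - Re w)\<^sup>2 + (Im w)\<^sup>2 > 0"
    by (auto simp: complex_eq_iff sum_power2_gt_zero_iff)
  moreover have "(Re w)\<^sup>2 + (Im w)\<^sup>2 < 1"
    using assms by (simp add: cmod_def)
  ultimately show ?thesis
    by (simp add: Re_divide power2_eq_square algebra_simps)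
qed

section \<open>Quadratic inequalities behind the lower bounds\<close>

text \<open>Here \<open>r\<close> is the positive zero of \<open>D y^2 - 1\<close>. For
  \<open>y \<le> r\<close> the bound is just \<open>g \<ge> 0\<close>. For \<open>y > r\<close> the
  lower bound \<open>(D y^2 - 1) / (2 (1 + 2 \<alpha>))\<close> on \<open>g\<close> grows with slope
  at least 1, because \<open>1 + 2 \<alpha> \<le> D r\<close>, so \<open>g - y\<close> stays above
  \<open>- r\<close>.\<close>

lemma log_coeff_sqrt_bound:
  fixes \<alpha> y g :: real
  assumes \<alpha>: "\<alpha> \<ge> 0" "\<alpha> \<le> (1 + sqrt 3) / 2" and g: "g \<ge> 0"
    and lower: "2 * (\<alpha>\<^sup>2 + 3 * \<alpha> + 1) * y\<^sup>2 - 1 \<le> 2 * (1 + 2 * \<alpha>) * g"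
  shows "- (1 / sqrt (2 * (\<alpha>\<^sup>2 + 3 * \<alpha> + 1))) \<le> g - y"
proof -
  define D where "D = 2 * (\<alpha>\<^sup>2 + 3 * \<alpha> + 1)"
  define r where "r = 1 / sqrt D"
  have D: "D > 0" using \<alpha> by (simp add: D_def add_nonneg_pos)
  have r: "r > 0" "D * r = sqrt D" using D by (simp_all add: r_def real_div_sqrt)
  have r2: "D * r\<^sup>2 = 1" using D by (simp add: r_def power_divide)
  \<comment> \<open>The threshold on \<alpha> enters here: \<open>(1 + 2 \<alpha>)^2 \<le> D\<close>
    is equivalent to \<open>(2 \<alpha> - 1)^2 \<le> 3\<close>.\<close>
  have "\<bar>2 * \<alpha> - 1\<bar> \<le> sqrt 3"
  proof (rule abs_leI)
    show "2 * \<alpha> - 1 \<le> sqrt 3" using \<alpha>(2) by (simp add: field_simps)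
    have "1 \<le> sqrt 3" by simp
    then show "- (2 * \<alpha> - 1) \<le> sqrt 3" using \<alpha>(1) by (simp del: real_sqrt_ge_1_iff)
  qed
  then have "(2 * \<alpha> - 1)\<^sup>2 \<le> 3" by (rule sqrt_ge_absD)
  then have "(1 + 2 * \<alpha>)\<^sup>2 \<le> D" by (simp add: D_def power2_eq_square algebra_simps)
  then have s: "1 + 2 * \<alpha> \<le> D * r" using r by (simp add: real_le_rsqrt)
  show ?thesis
  proof (cases "y \<le> r")
    case True
    then show ?thesis using g by (simp add: r_def D_def)
  next
    case False
    have "2 * (1 + 2 * \<alpha>) * (y - r) \<le> 2 * (D * r) * (y - r)"
      using s False by (intro mult_right_mono) auto
    also have "\<dots> \<le> D * (y + r) * (y - r)"
      using D False by (intro mult_right_mono) auto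
    also have "\<dots> = D * y\<^sup>2 - 1" using r2 by (simp add: algebra_simps power2_eq_square)
    also have "\<dots> \<le> 2 * (1 + 2 * \<alpha>) * g" using lower by (simp add: D_def)
    finally have "y - r \<le> g" using \<alpha> by simp
    then show ?thesis by (simp add: r_def D_def)
  qed
qed

text \<open>Completing the square: with \<open>D\<close> and \<open>s\<close> as in the proof,
  \<open>(2 D y^2 - 1) / (2 s) - y\<close> is least at \<open>y = s / (2 D)\<close>, with value
  \<open>- (2 D + s^2) / (4 s D)\<close>.\<close>

lemma log_coeff_quadratic_bound:
  fixes \<alpha> y g :: real
  assumes \<alpha>: "\<alpha> \<ge> 0"
    and lower: "2 * (\<alpha>\<^sup>2 + 3 * \<alpha> + 1) * y\<^sup>2 - 1 \<le> 2 * (1 + 2 * \<alpha>) * g"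
  shows "- ((6 * \<alpha>\<^sup>2 + 10 * \<alpha> + 3) / (4 * (2 * \<alpha> + 1) * (\<alpha>\<^sup>2 + 3 * \<alpha> + 1))) \<le> g - y"
proof -
  define D where "D = \<alpha>\<^sup>2 + 3 * \<alpha> + 1"
  define s where "s = 1 + 2 * \<alpha>"
  have D: "D > 0" and s: "s > 0" using \<alpha> by (simp_all add: D_def s_def add_nonneg_pos)
  have "0 \<le> (2 * D * y - s)\<^sup>2" by simp
  also have "\<dots> = 2 * D * (2 * D * y\<^sup>2 - 1) - 4 * s * D * y + (2 * D + s\<^sup>2)"
    by (simp add: power2_eq_square algebra_simps)
  also have "\<dots> \<le> 2 * D * (2 * s * g) - 4 * s * D * y + (2 * D + s\<^sup>2)"
    using lower D by (simp add: D_def s_def)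
  finally have "(y - g) * (4 * s * D) \<le> 2 * D + s\<^sup>2" by (simp add: algebra_simps)
  then have "y - g \<le> (2 * D + s\<^sup>2) / (4 * s * D)" using D s by (simp add: pos_le_divide_eq)
  also have "2 * D + s\<^sup>2 = 6 * \<alpha>\<^sup>2 + 10 * \<alpha> + 3"
    by (simp add: D_def s_def power2_eq_square algebra_simps)
  finally show ?thesis by (simp add: D_def s_def add.commute)
qed

section \<open>Estimates for the logarithmic coefficients and the upper bound\<close>

text \<open>The two descriptions of the coefficients of \<open>p\<close> are equated. The factor
  \<open>\<alpha>^2 + 4 \<alpha> + 1\<close> is \<open>(1 + \<alpha>)^2 + 2 \<alpha>\<close>: the
  square comes from \<open>c^2\<close>, the rest from the quadratic term in the second
  coefficient.\<close>

lemma alpha_convex_log_coeff_relation: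
  assumes \<alpha>: "\<alpha> \<ge> 0" and f: "f \<in> alpha_convex \<alpha>"
  obtains d where
    "2 * (1 + 2 * of_real \<alpha>) * log_coeff f 2
       = d + of_real (\<alpha>\<^sup>2 + 4 * \<alpha> + 1) * (log_coeff f 1)\<^sup>2"
    "norm d \<le> 1 - (1 + \<alpha>)\<^sup>2 * (norm (log_coeff f 1))\<^sup>2"
proof -
  obtain p where p: "p holomorphic_on ball 0 1" and A: "f \<in> class_A"
    and expr: "\<And>z. z \<in> ball 0 1 \<Longrightarrow> z = 0 \<or> f z \<noteq> 0 \<Longrightarrow> deriv f z \<noteq> 0 \<Longrightarrow>
                 p z = alpha_convex_expr \<alpha> f z"
    and pos: "\<And>z. z \<in> ball 0 1 \<Longrightarrow> Re (p z) > 0"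
    using f unfolding alpha_convex_def by blast
  have p0: "p 0 = 1"
    using expr[of 0] A by (simp add: class_A_def alpha_convex_expr_def)
  have P: "p has_fps_expansion fps_expansion p 0"
    by (rule holomorphic_on_ball_has_fps_expansion[OF p]) simp
  obtain c d where c: "fps_nth (fps_expansion p 0) 1 = 2 * c"
    and d: "fps_nth (fps_expansion p 0) 2 = 2 * (d + c\<^sup>2)" and d_le: "norm d \<le> 1 - (norm c)\<^sup>2"
    by (rule Caratheodory_coeffs[OF p p0 pos P])
  have c_eq: "c = (1 + of_real \<alpha>) * log_coeff f 1"
    using alpha_convex_coeffs(1)[OF A P expr] c
    by (simp add: mult.assoc del: distrib_left_numeral)
  show ?thesis
  proof (rule that)
    have "2 * (2 * (1 + 2 * of_real \<alpha>) * log_coeff f 2)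
       = 2 * (d + of_real (\<alpha>\<^sup>2 + 4 * \<alpha> + 1) * (log_coeff f 1)\<^sup>2)"
      using alpha_convex_coeffs(2)[OF A P expr] unfolding d c_eq
      by (simp add: power2_eq_square algebra_simps)
    then show "2 * (1 + 2 * of_real \<alpha>) * log_coeff f 2
       = d + of_real (\<alpha>\<^sup>2 + 4 * \<alpha> + 1) * (log_coeff f 1)\<^sup>2"
      by (subst (asm) mult_cancel_left) simp
    have "norm (1 + of_real \<alpha> :: complex) = 1 + \<alpha>"
      using \<alpha> norm_of_real[of "1 + \<alpha>", where 'a = complex] by simp
    then show "norm d \<le> 1 - (1 + \<alpha>)\<^sup>2 * (norm (log_coeff f 1))\<^sup>2"
      using d_le by (simp add: c_eq norm_mult power_mult_distrib)
  qed
qed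

text \<open>The first bound is \<open>norm d \<ge> 0\<close>; the others are the two triangle
  inequalities, with \<open>k - (1 + \<alpha>)^2 = 2 \<alpha>\<close> and
  \<open>k + (1 + \<alpha>)^2 = 2 (\<alpha>^2 + 3 \<alpha> + 1)\<close>.\<close>

lemma alpha_convex_norm_log_coeff:
  fixes \<alpha> :: real
  assumes \<alpha>: "\<alpha> \<ge> 0" and f: "f \<in> alpha_convex \<alpha>"
  defines "y \<equiv> norm (log_coeff f 1)" and "g \<equiv> norm (log_coeff f 2)"
  shows "(1 + \<alpha>) * y \<le> 1"
    and "2 * (1 + 2 * \<alpha>) * g \<le> 1 + 2 * \<alpha> * y\<^sup>2"
    and "2 * (\<alpha>\<^sup>2 + 3 * \<alpha> + 1) * y\<^sup>2 - 1 \<le> 2 * (1 + 2 * \<alpha>) * g"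
proof -
  define k where "k = \<alpha>\<^sup>2 + 4 * \<alpha> + 1"
  have k: "k \<ge> 0" using \<alpha> by (simp add: k_def)
  obtain d where eq: "2 * (1 + 2 * of_real \<alpha>) * log_coeff f 2 = d + of_real k * (log_coeff f 1)\<^sup>2"
    and d: "norm d \<le> 1 - (1 + \<alpha>)\<^sup>2 * y\<^sup>2"
    using alpha_convex_log_coeff_relation[OF \<alpha> f] unfolding k_def y_def by blast
  have "((1 + \<alpha>) * y)\<^sup>2 \<le> 1\<^sup>2"
    using d norm_ge_zero[of d] unfolding power_mult_distrib power_one by linarith
  then show "(1 + \<alpha>) * y \<le> 1" by (rule power2_le_imp_le) simp
  have g: "norm (d + of_real k * (log_coeff f 1)\<^sup>2) = 2 * (1 + 2 * \<alpha>) * g"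
    using \<alpha> norm_of_real[of "1 + 2 * \<alpha>", where 'a = complex]
    unfolding eq[symmetric] by (simp add: norm_mult g_def del: distrib_left_numeral)
  have ky: "norm (of_real k * (log_coeff f 1)\<^sup>2) = k * y\<^sup>2"
    using k by (simp add: norm_mult norm_power y_def)
  show "2 * (1 + 2 * \<alpha>) * g \<le> 1 + 2 * \<alpha> * y\<^sup>2"
    using norm_triangle_ineq[of d "of_real k * (log_coeff f 1)\<^sup>2"] d unfolding g ky
    by (simp add: k_def power2_eq_square algebra_simps)
  show "2 * (\<alpha>\<^sup>2 + 3 * \<alpha> + 1) * y\<^sup>2 - 1 \<le> 2 * (1 + 2 * \<alpha>) * g"
    using norm_diff_ineq[of "of_real k * (log_coeff f 1)\<^sup>2" d] d
    unfolding add.commute[of _ d] g ky by (simp add: k_def power2_eq_square algebra_simps)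
qed

text \<open>As \<open>y \<le> 1\<close>, the excess \<open>2 \<alpha> y^2\<close> in the bound for
  the second coefficient is at most \<open>2 \<alpha> y\<close>, hence at most
  \<open>2 (1 + 2 \<alpha>) y\<close>, which is what subtracting \<open>y\<close> removes.\<close>

lemma log_coeff_difference_le:
  fixes \<alpha> :: real
  assumes \<alpha>: "\<alpha> \<ge> 0" and f: "f \<in> alpha_convex \<alpha>"
  shows "norm (log_coeff f 2) - norm (log_coeff f 1) \<le> 1 / (2 * (1 + 2 * \<alpha>))"
proof -
  define y where "y = norm (log_coeff f 1)"
  have "(1 + \<alpha>) * y \<le> 1" unfolding y_def by (rule alpha_convex_norm_log_coeff[OF \<alpha> f])
  moreover have "0 \<le> \<alpha> * y" "y \<ge> 0" using \<alpha> by (simp_all add: y_def)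
  ultimately have "y \<le> 1" by (simp add: algebra_simps)
  then have "\<alpha> * y\<^sup>2 \<le> \<alpha> * y"
    using \<alpha> \<open>y \<ge> 0\<close> by (intro mult_left_mono) (simp_all add: power2_eq_square mult_left_le)
  then have "2 * (1 + 2 * \<alpha>) * norm (log_coeff f 2) \<le> 1 + 2 * (1 + 2 * \<alpha>) * y"
    using alpha_convex_norm_log_coeff(2)[OF \<alpha> f, folded y_def] \<open>y \<ge> 0\<close> \<open>0 \<le> \<alpha> * y\<close>
    by (simp add: algebra_simps)
  then have "(norm (log_coeff f 2) - y) * (2 * (1 + 2 * \<alpha>)) \<le> 1"
    by (simp add: algebra_simps)
  then show ?thesis using \<alpha> unfolding y_def by (simp add: pos_le_divide_eq)
qed

section \<open>Sharpness of the upper bound\<close>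

text \<open>The choice \<open>h z = z\<close> means \<open>c = 0\<close> and \<open>d = 1\<close>:
  the first logarithmic coefficient vanishes and the second is as large as the bound on
  \<open>d\<close> then permits.\<close>

lemma log_coeff_difference_sharp:
  fixes \<alpha> :: real
  assumes \<alpha>: "\<alpha> \<ge> 0"
  obtains f where "f \<in> alpha_convex \<alpha>"
    "norm (log_coeff f 2) - norm (log_coeff f 1) = 1 / (2 * (1 + 2 * \<alpha>))"
proof -
  define p :: "complex \<Rightarrow> complex" where "p = (\<lambda>z. (1 + z\<^sup>2) / (1 - z\<^sup>2))"
  have sq: "norm (z\<^sup>2) < 1" if "z \<in> ball 0 1" for z :: complex
    using that by (simp add: norm_power power_less_one_iff)
  then have ne: "1 - z\<^sup>2 \<noteq> 0" if "z \<in> ball 0 1" for z :: complex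
    using sq[OF that] by auto
  have p_hol: "p holomorphic_on ball 0 1"
    unfolding p_def by (intro holomorphic_intros ne)
  have pos: "Re (p z) > 0" if "z \<in> ball 0 1" for z
    unfolding p_def by (rule Re_Cayley_pos[OF sq[OF that]])
  obtain f where f: "f \<in> alpha_convex \<alpha>"
    and expr: "\<And>z. z \<in> ball 0 1 \<Longrightarrow> p z = alpha_convex_expr \<alpha> f z"
    using alpha_convex_exists[OF p_hol _ pos \<alpha>] by (auto simp: p_def)
  have A: "f \<in> class_A" using f by (simp add: alpha_convex_def)
  define P where "P = fps_expansion p 0"
  have P: "p has_fps_expansion P"
    unfolding P_def by (rule holomorphic_on_ball_has_fps_expansion[OF p_hol]) simp
  have ev: "eventually (\<lambda>z. p z * (1 - z ^ 2) = 1 + z ^ 2) (nhds 0)"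
    using eventually_nhds_in_open[of "ball 0 1" 0] ne
    by (auto simp: p_def elim!: eventually_mono)
  have eq: "P * (1 - fps_X ^ 2) = 1 + fps_X ^ 2"
    by (rule has_fps_expansion_eqI[OF _ _ ev]) (intro fps_expansion_intros P)+
  have P1: "fps_nth P 1 = 0"
    using arg_cong[OF eq, of "\<lambda>F. fps_nth F 1"] by (simp add: fps_mult_nth fps_X_power_nth)
  have P2: "fps_nth P 2 = 2"
    using arg_cong[OF eq, of "\<lambda>F. fps_nth F 2"] arg_cong[OF eq, of "\<lambda>F. fps_nth F 0"] P1
    by (simp add: fps_mult_nth numeral_2_eq_2 fps_X_power_nth)
  have "of_real (1 + \<alpha>) \<noteq> (0 :: complex)"
    unfolding of_real_eq_0_iff using \<alpha> by linarith
  then have \<gamma>1: "log_coeff f 1 = 0"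
    using alpha_convex_coeffs(1)[OF A P expr] P1
    by (simp add: mult.assoc del: distrib_left_numeral)
  then have "of_real (4 * (1 + 2 * \<alpha>)) * log_coeff f 2 = 2"
    using alpha_convex_coeffs(2)[OF A P expr] P2 by simp
  then have "\<bar>4 * (1 + 2 * \<alpha>)\<bar> * norm (log_coeff f 2) = 2"
    by (metis norm_mult norm_numeral norm_of_real)
  then have "norm (log_coeff f 2) - norm (log_coeff f 1) = 1 / (2 * (1 + 2 * \<alpha>))"
    using \<alpha> \<gamma>1 by (simp add: field_simps)
  with f that show ?thesis by blast
qed

theorem theorem4:
  fixes \<alpha> :: real
  assumes "\<alpha> \<ge> 0"
  shows "(\<forall>f \<in> alpha_convex \<alpha>.
           (\<alpha> \<le> (1 + sqrt 3) / 2 \<longrightarrow>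
              - (1 / sqrt (2 * (\<alpha>^2 + 3 * \<alpha> + 1)))
                \<le> cmod (log_coeff f 2) - cmod (log_coeff f 1) \<and>
              cmod (log_coeff f 2) - cmod (log_coeff f 1) \<le> 1 / (2 * (1 + 2 * \<alpha>))) \<and>
           (\<alpha> \<ge> (1 + sqrt 3) / 2 \<longrightarrow>
              - ((6 * \<alpha>^2 + 10 * \<alpha> + 3) / (4 * (2 * \<alpha> + 1) * (\<alpha>^2 + 3 * \<alpha> + 1)))
                \<le> cmod (log_coeff f 2) - cmod (log_coeff f 1) \<and>
              cmod (log_coeff f 2) - cmod (log_coeff f 1) \<le> 1 / (2 * (1 + 2 * \<alpha>)))) \<and>
         (\<exists>f \<in> alpha_convex \<alpha>.
           cmod (log_coeff f 2) - cmod (log_coeff f 1) = 1 / (2 * (1 + 2 * \<alpha>)))"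
proof (intro conjI ballI)
  fix f assume f: "f \<in> alpha_convex \<alpha>"
  note upper = log_coeff_difference_le[OF assms f]
  note lower = alpha_convex_norm_log_coeff(3)[OF assms f]
  show "\<alpha> \<le> (1 + sqrt 3) / 2 \<longrightarrow>
      - (1 / sqrt (2 * (\<alpha>\<^sup>2 + 3 * \<alpha> + 1))) \<le> cmod (log_coeff f 2) - cmod (log_coeff f 1) \<and>
      cmod (log_coeff f 2) - cmod (log_coeff f 1) \<le> 1 / (2 * (1 + 2 * \<alpha>))"
    using upper log_coeff_sqrt_bound[OF assms _ norm_ge_zero lower] by blast
  show "\<alpha> \<ge> (1 + sqrt 3) / 2 \<longrightarrow>
      - ((6 * \<alpha>\<^sup>2 + 10 * \<alpha> + 3) / (4 * (2 * \<alpha> + 1) * (\<alpha>\<^sup>2 + 3 * \<alpha> + 1)))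
        \<le> cmod (log_coeff f 2) - cmod (log_coeff f 1) \<and>
      cmod (log_coeff f 2) - cmod (log_coeff f 1) \<le> 1 / (2 * (1 + 2 * \<alpha>))"
    using upper log_coeff_quadratic_bound[OF assms lower] by blast
next
  show "\<exists>f \<in> alpha_convex \<alpha>.
      cmod (log_coeff f 2) - cmod (log_coeff f 1) = 1 / (2 * (1 + 2 * \<alpha>))"
    by (rule log_coeff_difference_sharp[OF assms]) blast
qed

end
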